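(* Let $G$ be a block graph of order $p$, let $\omega=|V(C_D(G))|$ be the number of detour central vertices, let $\mathcal{L}(G)=\sum_{u\in V(G)}\mathcal{L}(u)$, and let $\xi = \min\{|V(B)|-1 : B \text{ a block of } G \text{ containing the detour central vertex}\}$ if $\omega=1$ and $\xi=0$ if $\omega\ge 2$. Suppose there is an ordering $u_0,u_1,\dots,u_{p-1}$ of the vertices of $G$ such that (1) $\mathcal{L}(u_0)=0$ and $\mathcal{L}(u_{p-1})=\xi$ when $\omega=1$, and $\mathcal{L}(u_0)=\mathcal{L}(u_{p-1})=0$ when $\omega\ge 2$; (2) for each $0\le i\le p-2$, $u_i$ and $u_{i+1}$ are in different branches when $\omega=1$, and in opposite branches when $\omega\ge 2$; (3) $D(u_i,u_{i+1})\le \frac{p}{2}$ for $0\le i\le p-2$. Then $$hc(G) = (p-1)(p-\omega) - 2\mathcal{L}(G) + \xi,$$ and the map $c$ defined by $c(u_0)=0$ and $c(u_{i+1}) = c(u_i) + p - 1 - \mathcal{L}(u_i) - \mathcal{L}(u_{i+1}) - \omega + 1$ for $0\le i\le p-2$ is an optimal hamiltonian coloring of $G$ (a hamiltonian coloring with $hc(c)=hc(G)$).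
   Context: A block graph is a connected graph all of whose blocks are cliques. $D(u,v)$ (detour distance) is the length of a longest $u$–$v$ path. The detour eccentricity of $v$ is $\max_x D(v,x)$; the detour central vertices are those of minimum detour eccentricity, and $C_D(G)$ is the subgraph they induce. The detour level is $\mathcal{L}(u)=\min\{D(w,u): w \text{ a detour central vertex}\}$. For a vertex $v$, let $w$ be a detour central vertex nearest to $v$ (minimizing $D(w,v)$); a vertex $u$ lying on the (shortest) $w$–$v$ path is an ancestor of $v$, and $v$ is a descendant of $u$. If $B$ is a block containing a detour central vertex $w$ (and no other detour central vertex), the branch at $w$ determined by $B$ is the subgraph induced by the vertices of $B$ other than $w$ together with all their descendants. Two vertices are in different branches if no single branch contains both of them (their branches, if any, come from different blocks at the same central vertex); two vertices are in opposite branches if they are not associated with the same detour central vertex, i.e. they lie in branches at (or are themselves) different detour central vertices. A hamiltonian coloring of $G$ (order $p$) is a map $c:V(G)\to\{0,1,2,\dots\}$ with $D(u,v)+|c(u)-c(v)|\ge p-1$ for all distinct $u,v$; $hc(c)=\max_v c(v)$ and $hc(G)=\min_c hc(c)$ over all hamiltonian colorings. *)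

theory Defs
  imports Complex_Main "Graph_Theory.Graph_Theory"
begin

text \<open>A finite simple undirected graph is a digraph \<open>G\<close> with \<open>graph G\<close>: finite, symmetric, and
  without loops or parallel arcs; each edge is represented by its two opposite arcs.\<close>

section \<open>Blocks and block graphs\<close>

text \<open>The library's \<open>connected\<close> fails on the graph without vertices, so nonemptiness
  of \<open>H - v\<close> is required: the single vertex of \<open>K\<^sub>1\<close> is not a cut vertex.\<close>

definition cut_vertex :: "('a, 'b) pre_digraph \<Rightarrow> 'a \<Rightarrow> bool" where
  "cut_vertex H v \<longleftrightarrow>
     v \<in> verts H \<and> verts (pre_digraph.del_vert H v) \<noteq> {} \<and> \<not> connected (pre_digraph.del_vert H v)"

definition nonseparable :: "('a, 'b) pre_digraph \<Rightarrow> bool" where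
  "nonseparable H \<longleftrightarrow> graph H \<and> connected H \<and> (\<forall>v. \<not> cut_vertex H v)"

text \<open>Blocks are maximal nonseparable subgraphs. In particular \<open>K\<^sub>1\<close> is its own block.\<close>

definition is_block :: "('a, 'b) pre_digraph \<Rightarrow> ('a, 'b) pre_digraph \<Rightarrow> bool" where
  "is_block G B \<longleftrightarrow> pre_digraph.max_subgraph G nonseparable B"

definition block_graph :: "('a, 'b) pre_digraph \<Rightarrow> bool" where
  "block_graph G \<longleftrightarrow> graph G \<and> connected G \<and>
     (\<forall>B. is_block G B \<longrightarrow> complete_digraph (card (verts B)) B)"


section \<open>Detour distance, detour center and levels\<close>

definition detour_dist :: "('a, 'b) pre_digraph \<Rightarrow> 'a \<Rightarrow> 'a \<Rightarrow> nat" where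
  "detour_dist G u v = Max {length p | p. pre_digraph.apath G u p v}"

definition detour_ecc :: "('a, 'b) pre_digraph \<Rightarrow> 'a \<Rightarrow> nat" where
  "detour_ecc G v = Max (detour_dist G v ` verts G)"

definition detour_central :: "('a, 'b) pre_digraph \<Rightarrow> 'a set" where
  "detour_central G = {v \<in> verts G. detour_ecc G v = Min (detour_ecc G ` verts G)}"

definition detour_center :: "('a, 'b) pre_digraph \<Rightarrow> ('a, 'b) pre_digraph" where
  "detour_center G = G \<restriction> detour_central G"

definition omega :: "('a, 'b) pre_digraph \<Rightarrow> nat" where
  "omega G = card (verts (detour_center G))"

definition level :: "('a, 'b) pre_digraph \<Rightarrow> 'a \<Rightarrow> nat" where
  "level G u = Min ((\<lambda>w. detour_dist G w u) ` detour_central G)"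

definition total_level :: "('a, 'b) pre_digraph \<Rightarrow> nat" where
  "total_level G = (\<Sum>u\<in>verts G. level G u)"

definition xi :: "('a, 'b) pre_digraph \<Rightarrow> nat" where
  "xi G = (if omega G = 1
           then Min {card (verts B) - 1 | B. is_block G B \<and> detour_central G \<subseteq> verts B}
           else 0)"


section \<open>Branches\<close>

definition nearest_central :: "('a, 'b) pre_digraph \<Rightarrow> 'a \<Rightarrow> 'a \<Rightarrow> bool" where
  "nearest_central G w v \<longleftrightarrow> w \<in> detour_central G \<and> detour_dist G w v = level G v"

definition shortest_path :: "('a, 'b) pre_digraph \<Rightarrow> 'a \<Rightarrow> 'b awalk \<Rightarrow> 'a \<Rightarrow> bool" where
  "shortest_path G w p v \<longleftrightarrow> pre_digraph.apath G w p v \<and>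
     (\<forall>q. pre_digraph.apath G w q v \<longrightarrow> length p \<le> length q)"

definition ancestor :: "('a, 'b) pre_digraph \<Rightarrow> 'a \<Rightarrow> 'a \<Rightarrow> bool" where
  "ancestor G u v \<longleftrightarrow> (\<exists>w p. nearest_central G w v \<and> shortest_path G w p v \<and>
     u \<in> set (pre_digraph.awalk_verts G w p))"

abbreviation descendant :: "('a, 'b) pre_digraph \<Rightarrow> 'a \<Rightarrow> 'a \<Rightarrow> bool" where
  "descendant G v u \<equiv> ancestor G u v"

text \<open>The branch at \<open>w\<close> determined by the block \<open>B\<close>. A vertex lies on every shortest path
  ending in it, so it is one of its own descendants.\<close>

definition branch :: "('a, 'b) pre_digraph \<Rightarrow> 'a \<Rightarrow> ('a, 'b) pre_digraph \<Rightarrow> ('a, 'b) pre_digraph" where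
  "branch G w B =
     G \<restriction> ((verts B - {w}) \<union> {v \<in> verts G. \<exists>x \<in> verts B - {w}. descendant G v x})"

definition is_branch_at :: "('a, 'b) pre_digraph \<Rightarrow> 'a \<Rightarrow> ('a, 'b) pre_digraph \<Rightarrow> bool" where
  "is_branch_at G w R \<longleftrightarrow>
     (\<exists>B. is_block G B \<and> verts B \<inter> detour_central G = {w} \<and> R = branch G w B)"

definition different_branches :: "('a, 'b) pre_digraph \<Rightarrow> 'a \<Rightarrow> 'a \<Rightarrow> bool" where
  "different_branches G u v \<longleftrightarrow> \<not> (\<exists>w R. is_branch_at G w R \<and> u \<in> verts R \<and> v \<in> verts R)"

definition associated :: "('a, 'b) pre_digraph \<Rightarrow> 'a \<Rightarrow> 'a \<Rightarrow> bool" where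
  "associated G w v \<longleftrightarrow>
     w \<in> detour_central G \<and> (v = w \<or> (\<exists>R. is_branch_at G w R \<and> v \<in> verts R))"

text \<open>This notion is meant for \<open>omega G \<ge> 2\<close>.\<close>

definition opposite_branches :: "('a, 'b) pre_digraph \<Rightarrow> 'a \<Rightarrow> 'a \<Rightarrow> bool" where
  "opposite_branches G u v \<longleftrightarrow>
     (\<exists>w w'. w \<noteq> w' \<and> associated G w u \<and> associated G w' v)"


section \<open>Hamiltonian colorings\<close>

definition hamiltonian_coloring :: "('a, 'b) pre_digraph \<Rightarrow> ('a \<Rightarrow> nat) \<Rightarrow> bool" where
  "hamiltonian_coloring G c \<longleftrightarrow> (\<forall>u\<in>verts G. \<forall>v\<in>verts G. u \<noteq> v \<longrightarrow>
     int (detour_dist G u v) + \<bar>int (c u) - int (c v)\<bar> \<ge> int (card (verts G)) - 1)"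

definition hc_coloring :: "('a, 'b) pre_digraph \<Rightarrow> ('a \<Rightarrow> nat) \<Rightarrow> nat" where
  "hc_coloring G c = Max (c ` verts G)"

definition hc :: "('a, 'b) pre_digraph \<Rightarrow> nat" where
  "hc G = Inf {hc_coloring G c | c. hamiltonian_coloring G c}"

text \<open>Integer arithmetic is used because truncated subtraction on \<open>nat\<close> would change the recurrence
  whenever the increment is negative.\<close>

definition follows_recurrence ::
  "('a, 'b) pre_digraph \<Rightarrow> (nat \<Rightarrow> 'a) \<Rightarrow> ('a \<Rightarrow> nat) \<Rightarrow> bool" where
  "follows_recurrence G u c \<longleftrightarrow> c (u 0) = 0 \<and>
     (\<forall>i. i + 1 < card (verts G) \<longrightarrow>
        int (c (u (i + 1))) = int (c (u i)) + int (card (verts G)) - 1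
          - int (level G (u i)) - int (level G (u (i + 1))) - int (omega G) + 1)"

end

theory Submission
  imports Defs
begin

text \<open>In a block graph every vertex \<open>v\<close> has a gate in each block \<open>C\<close>: one vertex of \<open>C\<close> lying on all
  paths from \<open>v\<close> to \<open>C\<close>. Since detour distance is additive along separating vertices, a gate lies
  on every longest path into \<open>C\<close>; minimality of the eccentricity forbids a third vertex separating
  two detour central vertices, so for \<open>\<omega> \<ge> 2\<close> they fill a block and are \<open>\<omega> - 1\<close> apart. Hence
  \<open>D(u, v) \<le> L(u) + L(v) + \<omega> - 1\<close>, with equality for different (opposite) branches. Summing the
  coloring condition along the vertices sorted by color gives the lower bound. For the coloring of the
  recurrence, consecutive vertices meet the condition with equality, and \<open>D \<le> p / 2\<close> makes any two
  steps climb at least \<open>p - 2\<close>, which settles all other pairs.\<close>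


section \<open>Paths and their vertex sets\<close>

text \<open>The arc lists of \<open>apath\<close> are replaced by vertex sets: in a simple graph this loses nothing
  about lengths, and cutting, gluing and reversing paths become set identities.\<close>

inductive path_on :: "('a, 'b) pre_digraph \<Rightarrow> 'a \<Rightarrow> 'a set \<Rightarrow> 'a \<Rightarrow> bool" for G where
  single: "x \<in> verts G \<Longrightarrow> path_on G x {x} x"
| step: "x \<in> verts G \<Longrightarrow> x \<rightarrow>\<^bsub>G\<^esub> y \<Longrightarrow> path_on G y A z \<Longrightarrow> x \<notin> A \<Longrightarrow> path_on G x (insert x A) z"

text \<open>An endpoint counts as separating, since a path contains its ends. This lets a gate
  coincide with the vertex it belongs to or with the target, without a case distinction.\<close>

definition separates :: "('a, 'b) pre_digraph \<Rightarrow> 'a \<Rightarrow> 'a \<Rightarrow> 'a \<Rightarrow> bool" where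
  "separates G w x y \<longleftrightarrow> (\<forall>A. path_on G x A y \<longrightarrow> w \<in> A)"

text \<open>The empty set qualifies, unlike for \<open>connected\<close>, so that deleting the only
  vertex of a set is no exception.\<close>

definition linked :: "('a, 'b) pre_digraph \<Rightarrow> 'a set \<Rightarrow> bool" where
  "linked G S \<longleftrightarrow> (\<forall>x\<in>S. \<forall>y\<in>S. \<exists>A\<subseteq>S. path_on G x A y)"

lemma path_on_ends: "path_on G x A y \<Longrightarrow> x \<in> A \<and> y \<in> A"
  by (induction rule: path_on.induct) auto

lemma path_on_finite: "path_on G x A y \<Longrightarrow> finite A"
  by (induction rule: path_on.induct) auto

lemma path_on_verts: "path_on G x A y \<Longrightarrow> A \<subseteq> verts G"
  by (induction rule: path_on.induct) auto

lemma path_on_first_edge: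
  assumes "path_on G x A y" "x \<noteq> y"
  obtains t B where "x \<rightarrow>\<^bsub>G\<^esub> t" "path_on G t B y" "x \<notin> B" "A = insert x B"
  using assms(1)
proof (cases rule: path_on.cases)
  case (step t B)
  with that show thesis by simp
qed (use assms(2) in simp)

lemma path_on_mono:
  assumes "path_on H x A y" "verts H \<subseteq> verts G" "arcs_ends H \<subseteq> arcs_ends G"
  shows "path_on G x A y"
  using assms
proof (induction rule: path_on.induct)
  case (step x y A z)
  then show ?case by (intro path_on.step) auto
qed (auto intro: path_on.single)

lemma path_on_split:
  assumes "path_on G x A y" "w \<in> A"
  obtains B C where "path_on G x B w" "path_on G w C y" "B \<union> C = A" "B \<inter> C = {w}"
proof -
  have "\<exists>B C. path_on G x B w \<and> path_on G w C y \<and> B \<union> C = A \<and> B \<inter> C = {w}"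
    using assms
  proof (induction rule: path_on.induct)
    case (single x)
    then show ?case by (auto intro: path_on.single)
  next
    case (step x y A z)
    show ?case
    proof (cases "w = x")
      case True
      moreover have "path_on G x {x} x" using step.hyps(1) by (rule path_on.single)
      moreover have "path_on G x (insert x A) z" using step.hyps by (rule path_on.step)
      ultimately show ?thesis by blast
    next
      case False
      with step.prems step.IH
      obtain B C where BC: "path_on G y B w" "path_on G w C z" "B \<union> C = A" "B \<inter> C = {w}"
        by blast
      have x: "x \<notin> B" "x \<notin> C" using BC(3) step.hyps(4) by auto
      have "path_on G x (insert x B) w" using step.hyps(1,2) BC(1) x(1) by (rule path_on.step)
      moreover have "insert x B \<union> C = insert x A" "insert x B \<inter> C = {w}" using BC x by auto
      ultimately show ?thesis using BC(2) by blast
    qed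
  qed
  with that show thesis by blast
qed

lemma path_on_concat:
  assumes "path_on G x A y" "path_on G y B z" "A \<inter> B = {y}"
  shows "path_on G x (A \<union> B) z"
  using assms
proof (induction rule: path_on.induct)
  case (single x)
  then show ?case using path_on_ends[of G x B z] by (simp add: insert_absorb)
next
  case (step x t A y)
  then have "path_on G t (A \<union> B) z" "x \<notin> A \<union> B"
    using path_on_ends[of G t A y] by auto
  then have "path_on G x (insert x (A \<union> B)) z" using step.hyps path_on.step by metis
  then show ?case by simp
qed

text \<open>The two paths may overlap, so their union need not be a path. The induction takes a
  shortcut whenever the rest of the path already contains the new vertex; the inclusion in
  \<open>A \<union> B\<close> records that vertices avoided by both paths stay avoided.\<close>

lemma path_on_trans:
  assumes "path_on G x A y" "path_on G y B z"
  obtains C where "path_on G x C z" "C \<subseteq> A \<union> B"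
proof -
  have "\<exists>C\<subseteq>A \<union> B. path_on G x C z"
    using assms
  proof (induction rule: path_on.induct)
    case (single x)
    then show ?case by auto
  next
    case (step x t A y)
    then obtain C where C: "C \<subseteq> A \<union> B" "path_on G t C z" by auto
    show ?case
    proof (cases "x \<in> C")
      case True
      with C(2) obtain D E where "path_on G x E z" "D \<union> E = C" by (rule path_on_split)
      with C(1) show ?thesis by blast
    next
      case False
      with step.hyps C show ?thesis by (intro exI[of _ "insert x C"]) (auto intro: path_on.step)
    qed
  qed
  with that show thesis by blast
qed

lemma path_on_first_hit:
  assumes "path_on G x A y" "y \<in> S"
  obtains z B where "path_on G x B z" "B \<subseteq> A" "B \<inter> S = {z}"
proof -
  have "\<exists>z B. path_on G x B z \<and> B \<subseteq> A \<and> B \<inter> S = {z}"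
    using assms
  proof (induction rule: path_on.induct)
    case (single x)
    then show ?case by (auto intro: path_on.single)
  next
    case (step x t A y)
    show ?case
    proof (cases "x \<in> S")
      case True
      with step.hyps show ?thesis by (intro exI[of _ x] exI[of _ "{x}"]) (auto intro: path_on.single)
    next
      case False
      from step obtain z B where "path_on G t B z" "B \<subseteq> A" "B \<inter> S = {z}" by auto
      with step.hyps False show ?thesis
        by (intro exI[of _ z] exI[of _ "insert x B"]) (auto intro: path_on.step)
    qed
  qed
  with that show thesis by blast
qed

text \<open>A Hamiltonian path of the clique with prescribed ends: remove the start and continue
  from any third vertex. It supplies the lower bound for detours inside a complete block.\<close>

lemma path_on_clique:
  assumes "finite S" "S \<subseteq> verts G" "x \<in> S" "y \<in> S" "x \<noteq> y"
    and "\<And>a b. a \<in> S \<Longrightarrow> b \<in> S \<Longrightarrow> a \<noteq> b \<Longrightarrow> a \<rightarrow>\<^bsub>G\<^esub> b"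
  shows "path_on G x S y"
  using assms
proof (induction S arbitrary: x rule: finite_psubset_induct)
  case (psubset S)
  show ?case
  proof (cases "S = {x, y}")
    case True
    have "y \<in> verts G" using psubset.prems by blast
    then have "path_on G x (insert x {y}) y"
      using psubset.prems by (intro path_on.step[OF _ _ path_on.single]) auto
    with True show ?thesis by simp
  next
    case False
    then obtain t where t: "t \<in> S" "t \<noteq> x" "t \<noteq> y" using psubset.prems by blast
    have "path_on G t (S - {x}) y"
      using psubset.prems t by (intro psubset.IH) auto
    then have "path_on G x (insert x (S - {x})) y"
      using psubset.prems t by (intro path_on.step) auto
    with psubset.prems show ?thesis by (simp add: insert_absorb)
  qed
qed

lemma path_on_induce:
  assumes "S \<subseteq> verts G"
  shows "path_on (G \<restriction> S) x A y \<longleftrightarrow> path_on G x A y \<and> A \<subseteq> S"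
proof
  assume p: "path_on (G \<restriction> S) x A y"
  have "path_on G x A y"
  proof (rule path_on_mono[OF p])
    show "verts (G \<restriction> S) \<subseteq> verts G" using assms by simp
    show "arcs_ends (G \<restriction> S) \<subseteq> arcs_ends G" by (auto simp: arcs_ends_conv)
  qed
  with path_on_verts[OF p] show "path_on G x A y \<and> A \<subseteq> S" by simp
next
  assume "path_on G x A y \<and> A \<subseteq> S"
  then have "path_on G x A y" "A \<subseteq> S" by auto
  then show "path_on (G \<restriction> S) x A y"
  proof (induction rule: path_on.induct)
    case (step x y A z)
    then have "x \<in> S" "y \<in> S" using path_on_ends[of G y A z] by auto
    moreover from step.hyps this have "x \<rightarrow>\<^bsub>G \<restriction> S\<^esub> y" by (auto simp: arcs_ends_conv)
    ultimately show ?case using step by (intro path_on.step) auto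
  qed (auto intro: path_on.single)
qed

context graph
begin

lemma adj_sym: "x \<rightarrow>\<^bsub>G\<^esub> y \<Longrightarrow> y \<rightarrow>\<^bsub>G\<^esub> x"
  by (rule graph_symmetric)

lemma path_on_edge:
  assumes "x \<rightarrow>\<^bsub>G\<^esub> y"
  shows "path_on G x {x, y} y"
proof (rule path_on.step[OF _ assms path_on.single])
  show "x \<in> verts G" "y \<in> verts G" "x \<notin> {y}"
    using adj_in_verts[OF assms] adj_not_same assms by auto
qed

lemma path_on_rev: "path_on G x A y \<Longrightarrow> path_on G y A x"
proof (induction rule: path_on.induct)
  case (step x t A y)
  have "path_on G y (A \<union> {t, x}) x"
    using step.IH path_on_edge[OF adj_sym[OF step.hyps(2)]]
    by (rule path_on_concat) (use step.hyps path_on_ends[of G t A y] in auto)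
  moreover have "A \<union> {t, x} = insert x A" using step.hyps path_on_ends[of G t A y] by auto
  ultimately show ?case by simp
qed (rule path_on.single)

lemma separates_sym: "separates G w x y \<longleftrightarrow> separates G w y x"
  by (auto simp: separates_def intro: path_on_rev)

text \<open>Not being separated by \<open>w\<close> means lying in the same component once
  \<open>w\<close> is deleted. Most separation arguments below are instances of this
  transitivity.\<close>

lemma not_separates_trans:
  assumes "\<not> separates G w x y" "\<not> separates G w y z"
  shows "\<not> separates G w x z"
proof -
  obtain A B where AB: "path_on G x A y" "w \<notin> A" "path_on G y B z" "w \<notin> B"
    using assms unfolding separates_def by blast
  obtain C where "path_on G x C z" "C \<subseteq> A \<union> B"
    using AB(1,3) by (rule path_on_trans)
  with AB(2,4) show ?thesis unfolding separates_def by blast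
qed

lemma reachable_iff_path_on: "x \<rightarrow>\<^sup>* y \<longleftrightarrow> (\<exists>A. path_on G x A y)"
proof
  assume "x \<rightarrow>\<^sup>* y"
  then show "\<exists>A. path_on G x A y"
  proof (induction rule: converse_reachable_induct)
    case base
    then show ?case by (auto intro: path_on.single)
  next
    case (step x t)
    then obtain A where "path_on G t A y" by blast
    with path_on_edge[OF step.hyps(1)] show ?case by (rule path_on_trans) blast
  qed
next
  assume "\<exists>A. path_on G x A y"
  then obtain A where "path_on G x A y" ..
  then show "x \<rightarrow>\<^sup>* y"
    by (induction rule: path_on.induct) (auto intro: adj_reachable_trans)
qed

lemma connected_iff_linked: "connected G \<longleftrightarrow> verts G \<noteq> {} \<and> linked G (verts G)"
proof -
  have "x \<rightarrow>\<^sup>*\<^bsub>mk_symmetric G\<^esub> y \<longleftrightarrow> (\<exists>A\<subseteq>verts G. path_on G x A y)" for x y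
    using reachable_mk_symmetric_eq[OF sym_arcs] reachable_iff_path_on[of x y] path_on_verts[of G x _ y]
    by blast
  then show ?thesis unfolding connected_def strongly_connected_def linked_def by simp
qed

lemma graph_induce:
  assumes "S \<subseteq> verts G"
  shows "graph (G \<restriction> S)"
  using digraphI_induced[OF induced_induce[OF assms]]
    induced_graph_imp_symmetric[OF sym_arcs induced_induce[OF assms]]
  by (rule digraph.graphI)

lemma linked_induce:
  assumes "S \<subseteq> verts G" "T \<subseteq> S"
  shows "linked (G \<restriction> S) T \<longleftrightarrow> linked G T"
proof -
  have "(\<exists>A\<subseteq>T. path_on (G \<restriction> S) x A y) \<longleftrightarrow> (\<exists>A\<subseteq>T. path_on G x A y)" for x y
    using assms(2) by (auto simp: path_on_induce[OF assms(1)])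
  then show ?thesis unfolding linked_def by simp
qed

lemma linkedI_center:
  assumes "\<And>x. x \<in> S \<Longrightarrow> \<exists>A\<subseteq>S. path_on G x A c"
  shows "linked G S"
  unfolding linked_def
proof (intro ballI)
  fix x y assume "x \<in> S" "y \<in> S"
  with assms obtain A B where "A \<subseteq> S" "path_on G x A c" "B \<subseteq> S" "path_on G y B c" by meson
  moreover from this obtain C where "path_on G x C y" "C \<subseteq> A \<union> B"
    using path_on_trans[OF _ path_on_rev] by metis
  ultimately show "\<exists>A\<subseteq>S. path_on G x A y" by blast
qed

lemma linked_Un:
  assumes "linked G S" "linked G T" "c \<in> S" "c \<in> T"
  shows "linked G (S \<union> T)"
proof (rule linkedI_center)
  fix x assume "x \<in> S \<union> T"
  with assms have "(\<exists>A\<subseteq>S. path_on G x A c) \<or> (\<exists>A\<subseteq>T. path_on G x A c)"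
    unfolding linked_def by blast
  then show "\<exists>A\<subseteq>S \<union> T. path_on G x A c" by blast
qed

end

section \<open>Blocks\<close>

text \<open>A vertex set suffices to describe a block, because maximality makes every block an
  induced subgraph. For \<open>v\<close> outside \<open>S\<close> the last clause repeats that
  \<open>S\<close> is linked, and singletons qualify.\<close>

definition nonsep :: "('a, 'b) pre_digraph \<Rightarrow> 'a set \<Rightarrow> bool" where
  "nonsep G S \<longleftrightarrow> S \<subseteq> verts G \<and> S \<noteq> {} \<and> linked G S \<and> (\<forall>v. linked G (S - {v}))"

context graph
begin

lemma del_vert_eq_induce: "del_vert v = G \<restriction> (verts G - {v})"
  by (auto simp: del_vert_def induce_subgraph_def wellformed)

text \<open>The delicate case is the deletion of a sole vertex: there \<open>cut_vertex\<close>
  fails by its nonemptiness clause, and the empty set is \<open>linked\<close> vacuously.\<close>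

lemma nonseparable_iff: "nonseparable G \<longleftrightarrow> nonsep G (verts G)"
proof -
  have "cut_vertex G v \<longleftrightarrow> v \<in> verts G \<and> \<not> linked G (verts G - {v})" for v
    using graph.connected_iff_linked[OF graph_induce[of "verts G - {v}"]]
      linked_induce[of "verts G - {v}" "verts G - {v}"]
    by (auto simp: cut_vertex_def del_vert_eq_induce) (auto simp: linked_def)
  moreover have "linked G (verts G) \<Longrightarrow> v \<notin> verts G \<Longrightarrow> linked G (verts G - {v})" for v
    by simp
  ultimately show ?thesis
    unfolding nonseparable_def nonsep_def connected_iff_linked using graph_axioms by blast
qed

lemma nonseparable_induce_iff:
  assumes "S \<subseteq> verts G"
  shows "nonseparable (G \<restriction> S) \<longleftrightarrow> nonsep G S"
proof -
  have "linked (G \<restriction> S) S \<longleftrightarrow> linked G S" "linked (G \<restriction> S) (S - {v}) \<longleftrightarrow> linked G (S - {v})" for v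
    using linked_induce[OF assms] by auto
  then show ?thesis
    using graph.nonseparable_iff[OF graph_induce[OF assms]] assms unfolding nonsep_def by simp
qed

lemma nonsep_subgraph:
  assumes "subgraph H G" "nonseparable H"
  shows "nonsep G (verts H)"
proof -
  have gH: "graph H" using assms(2) by (simp add: nonseparable_def)
  have H: "nonsep H (verts H)" using graph.nonseparable_iff[OF gH] assms(2) by simp
  note mono = path_on_mono[OF _ subgraph_imp_subverts[OF assms(1)] arcs_ends_mono[OF assms(1)]]
  have "linked G T" if "linked H T" for T
    unfolding linked_def
  proof (intro ballI)
    fix x y assume "x \<in> T" "y \<in> T"
    with that obtain A where A: "A \<subseteq> T" "path_on H x A y" unfolding linked_def by blast
    with mono[OF A(2)] show "\<exists>A\<subseteq>T. path_on G x A y" by (intro exI[of _ A] conjI)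
  qed
  with H show ?thesis
    using subgraph_imp_subverts[OF assms(1)] unfolding nonsep_def by simp
qed

lemma subgraph_induce_self:
  assumes "subgraph H G" "verts H \<subseteq> S"
  shows "subgraph H (G \<restriction> S)"
proof -
  interpret H: wf_digraph H using assms(1) by (rule subgraphE)
  have c: "tail H = tail G" "head H = head G" "arcs H \<subseteq> arcs G"
    using assms(1) by (auto simp: subgraph_def compatible_def)
  have "arcs H \<subseteq> arcs (G \<restriction> S)"
  proof
    fix e assume "e \<in> arcs H"
    with H.wellformed[of e] c assms(2) show "e \<in> arcs (G \<restriction> S)" by auto
  qed
  with c assms(2) wellformed_induce_subgraph[of S] H.wf_digraph show ?thesis
    by (simp add: subgraph_def compatible_def)
qed

lemma block_nonsep: "is_block G B \<Longrightarrow> nonsep G (verts B)"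
  unfolding is_block_def max_subgraph_def by (blast intro: nonsep_subgraph)

lemma block_maximal:
  assumes "is_block G B" "nonsep G S" "verts B \<subseteq> S"
  shows "S = verts B"
proof -
  have S: "S \<subseteq> verts G" using assms(2) by (simp add: nonsep_def)
  then have "nonseparable (G \<restriction> S)" "subgraph (G \<restriction> S) G"
    using assms(2) nonseparable_induce_iff by (auto intro: subgraph_induce_subgraphI)
  moreover have "subgraph B (G \<restriction> S)"
    using assms(1,3) by (auto simp: is_block_def max_subgraph_def intro: subgraph_induce_self)
  ultimately have "G \<restriction> S = B"
    using assms(1) unfolding is_block_def max_subgraph_def by blast
  then show ?thesis by auto
qed

text \<open>By finiteness, \<open>S\<close> extends to an inclusion-maximal nonseparable vertex set;
  the subgraph induced by it is then maximal among subgraphs too.\<close>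

lemma nonsep_in_block:
  assumes "nonsep G S"
  obtains B where "is_block G B" "S \<subseteq> verts B"
proof -
  let ?P = "\<lambda>T. nonsep G T \<and> S \<subseteq> T"
  have "finite {T. ?P T}"
    by (rule finite_subset[of _ "Pow (verts G)"]) (auto simp: nonsep_def)
  moreover have "S \<in> {T. ?P T}" using assms by simp
  ultimately obtain T where T: "?P T" and max: "\<And>U. ?P U \<Longrightarrow> T \<subseteq> U \<Longrightarrow> U = T"
    using finite_has_maximal2[of "{T. ?P T}" S] by (metis (mono_tags, lifting) mem_Collect_eq)
  have TV: "T \<subseteq> verts G" using T by (simp add: nonsep_def)
  have "is_block G (G \<restriction> T)"
    unfolding is_block_def max_subgraph_def
  proof (intro conjI allI impI notI)
    show "subgraph (G \<restriction> T) G" using TV by (rule subgraph_induce_subgraphI)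
    show "nonseparable (G \<restriction> T)" using T TV nonseparable_induce_iff by simp
    fix H assume "H \<noteq> G \<restriction> T \<and> subgraph (G \<restriction> T) H" "subgraph H G \<and> nonseparable H"
    then have H: "H \<noteq> G \<restriction> T" "subgraph (G \<restriction> T) H" "subgraph H G" "nonseparable H" by auto
    have TH: "T \<subseteq> verts H" using subgraph_imp_subverts[OF H(2)] by simp
    have vH: "verts H = T" using max[of "verts H"] nonsep_subgraph[OF H(3,4)] T TH by auto
    \<comment> \<open>A competitor \<open>H\<close> has no further vertices, so it lies inside the
      induced subgraph that it contains; the two inclusions leave no room for other arcs.\<close>
    have "subgraph H (G \<restriction> T)" using subgraph_induce_self[OF H(3)] vH by simp
    with H(2) have "arcs H = arcs (G \<restriction> T)" "tail H = tail G" "head H = head G"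
      by (auto simp: subgraph_def compatible_def)
    with vH have "H = G \<restriction> T" by (auto simp: induce_subgraph_def)
    with H(1) show False ..
  qed
  with that T show thesis by simp
qed

text \<open>Deleting one vertex leaves \<open>a\<close> or \<open>b\<close> in place, and the
  survivor still ties the two blocks together. So their union is nonseparable, and maximality
  identifies both with it.\<close>

lemma block_unique:
  assumes "is_block G B" "is_block G B'" "a \<noteq> b" "{a, b} \<subseteq> verts B \<inter> verts B'"
  shows "verts B = verts B'"
proof -
  have n: "nonsep G (verts B)" "nonsep G (verts B')" using assms block_nonsep by auto
  have "linked G (verts B \<union> verts B' - {v})" for v
  proof -
    obtain c where "c \<in> {a, b}" "c \<noteq> v" using assms(3) by blast
    then show ?thesis
      using linked_Un[of "verts B - {v}" "verts B' - {v}" c] n assms(4)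
      by (auto simp: nonsep_def Un_Diff)
  qed
  moreover have "linked G (verts B \<union> verts B')"
    using linked_Un[of "verts B" "verts B'" a] n assms(4) by (auto simp: nonsep_def)
  ultimately have "nonsep G (verts B \<union> verts B')" using n by (auto simp: nonsep_def)
  then show ?thesis using block_maximal assms(1,2) by (metis Un_upper1 Un_upper2)
qed

section \<open>Cycles lie inside blocks\<close>

lemma path_on_avoid_last:
  assumes "path_on G x A v" "a \<in> A - {v}"
  obtains C where "C \<subseteq> A - {v}" "path_on G a C x"
proof -
  obtain B C where BC: "path_on G x B a" "path_on G a C v" "B \<union> C = A" "B \<inter> C = {a}"
    using path_on_split[OF assms(1)] assms(2) by auto
  then have "v \<notin> B" using assms(2) path_on_ends[OF BC(2)] by auto
  with BC(3) have "B \<subseteq> A - {v}" by blast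
  with path_on_rev[OF BC(1)] that show thesis by blast
qed

text \<open>\<open>insert w A\<close> is a cycle through \<open>w\<close>, degenerating to an edge
  if \<open>x = y\<close>. Deleting \<open>w\<close> leaves the path \<open>A\<close>. Deleting a
  vertex \<open>v\<close> of \<open>A\<close> leaves two arcs, and each remaining vertex follows its
  arc away from \<open>v\<close> back to \<open>w\<close>.\<close>

lemma cycle_nonsep:
  assumes "w \<rightarrow>\<^bsub>G\<^esub> x" "w \<rightarrow>\<^bsub>G\<^esub> y" "path_on G x A y" "w \<notin> A"
  shows "nonsep G (insert w A)"
proof -
  \<comment> \<open>Stated for an arbitrary neighbor \<open>t\<close> of \<open>w\<close>, so that
    it serves both arcs: the one starting at \<open>x\<close> and, reversed, the one starting at
    \<open>y\<close>.\<close>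
  have to_end: "\<exists>D\<subseteq>insert w A - {v}. path_on G a D w"
    if h: "path_on G t C v" "w \<rightarrow>\<^bsub>G\<^esub> t" "C \<subseteq> A" "a \<in> C - {v}" for t v C a
  proof -
    obtain D where D: "D \<subseteq> C - {v}" "path_on G a D t" using path_on_avoid_last[OF h(1,4)] .
    have v: "v \<in> A" using subsetD[OF h(3)] path_on_ends[OF h(1)] by simp
    have t: "t \<in> D" using path_on_ends[OF D(2)] by simp
    have "path_on G a (D \<union> {t, w}) w"
    proof (rule path_on_concat[OF D(2) path_on_edge[OF adj_sym[OF h(2)]]])
      show "D \<inter> {t, w} = {t}" using D(1) h(3) t assms(4) by auto
    qed
    moreover have "D \<union> {t, w} \<subseteq> insert w A - {v}" using D h(3) t v assms(4) by auto
    ultimately show ?thesis by blast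
  qed
  have wV: "w \<in> verts G" using assms(1) by (rule adj_in_verts)
  have sub: "\<exists>D\<subseteq>A. path_on G a D x" if a: "a \<in> A" for a
  proof -
    obtain B where "path_on G x B a" "B \<subseteq> A" using path_on_split[OF assms(3) a] by blast
    with path_on_rev[OF this(1)] show ?thesis by blast
  qed
  then have lA: "linked G A" by (rule linkedI_center)
  have l: "linked G (insert w A)"
  proof (rule linkedI_center)
    fix a assume "a \<in> insert w A"
    moreover have "path_on G w {w, x} x" "{w, x} \<subseteq> insert w A"
      using path_on_edge[OF assms(1)] path_on_ends[OF assms(3)] by auto
    ultimately show "\<exists>D\<subseteq>insert w A. path_on G a D x"
      using sub by (metis insertE subset_insertI2)
  qed
  have "linked G (insert w A - {v})" for v
  proof (cases "v \<in> A")
    case True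
    then have vw: "v \<noteq> w" using assms(4) by blast
    obtain B C where BC: "path_on G x B v" "path_on G v C y" "B \<union> C = A" "B \<inter> C = {v}"
      using path_on_split[OF assms(3) True] .
    show ?thesis
    proof (rule linkedI_center[of _ w])
      fix a assume a: "a \<in> insert w A - {v}"
      consider "a = w" | "a \<in> B - {v}" | "a \<in> C - {v}" using a BC by blast
      then show "\<exists>D\<subseteq>insert w A - {v}. path_on G a D w"
      proof cases
        case 1
        with path_on.single[OF wV] vw show ?thesis by (intro exI[of _ "{w}"]) simp
      next
        case 2
        show ?thesis by (rule to_end[OF BC(1) assms(1) _ 2]) (use BC(3) in blast)
      next
        case 3
        show ?thesis by (rule to_end[OF path_on_rev[OF BC(2)] assms(2) _ 3]) (use BC(3) in blast)
      qed
    qed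
  next
    case False
    then show ?thesis using l lA assms(4) by (cases "v = w") auto
  qed
  with l wV path_on_verts[OF assms(3)] show ?thesis by (auto simp: nonsep_def)
qed

lemma cycle_in_block:
  assumes "w \<rightarrow>\<^bsub>G\<^esub> x" "w \<rightarrow>\<^bsub>G\<^esub> y" "path_on G x A y" "w \<notin> A"
  obtains B where "is_block G B" "{w, x, y} \<subseteq> verts B"
proof -
  obtain B where B: "is_block G B" "insert w A \<subseteq> verts B"
    using cycle_nonsep[OF assms] by (rule nonsep_in_block)
  then have "{w, x, y} \<subseteq> verts B" using path_on_ends[OF assms(3)] by auto
  with B(1) show thesis by (rule that)
qed

end


section \<open>Detour distance\<close>

context graph
begin

lemma apath_imp_path_on:
  "apath x p y \<Longrightarrow> path_on G x (set (awalk_verts x p)) y \<and> card (set (awalk_verts x p)) = Suc (length p)"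
proof (induction p arbitrary: x)
  case Nil
  then show ?case by (auto simp: apath_Nil_iff intro: path_on.single)
next
  case (Cons e p)
  then have e: "e \<in> arcs G" "tail G e = x" "apath (head G e) p y" "x \<notin> set (awalk_verts (head G e) p)"
    by (auto simp: apath_Cons_iff)
  have "x \<in> verts G" "x \<rightarrow>\<^bsub>G\<^esub> head G e"
    using e(1,2) in_arcs_imp_in_arcs_ends[OF e(1)] by auto
  with Cons.IH[OF e(3)] e(2,4) show ?case
    by (auto intro: path_on.step)
qed

lemma path_on_imp_apath:
  assumes "path_on G x A y"
  obtains p where "apath x p y" "set (awalk_verts x p) = A"
proof -
  have "\<exists>p. apath x p y \<and> set (awalk_verts x p) = A"
    using assms
  proof (induction rule: path_on.induct)
    case (single x)
    then show ?case by (intro exI[of _ "[]"]) (simp add: apath_Nil_iff)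
  next
    case (step x t A y)
    obtain p where p: "apath t p y" "set (awalk_verts t p) = A" using step.IH by blast
    obtain e where e: "e \<in> arcs G" "tail G e = x" "head G e = t" using step.hyps(2) by auto
    show ?case using p e step.hyps(4) by (intro exI[of _ "e # p"]) (simp add: apath_Cons_iff)
  qed
  with that show thesis by blast
qed

lemma apath_lengths_finite: "finite {length p |p. apath x p y}"
proof (rule finite_subset)
  show "{length p |p. apath x p y} \<subseteq> {..card (verts G)}"
  proof
    fix n assume "n \<in> {length p |p. apath x p y}"
    then obtain p where p: "apath x p y" "n = length p" by auto
    have "card (set (awalk_verts x p)) \<le> card (verts G)"
      using apath_imp_path_on[OF p(1)] by (intro card_mono path_on_verts) auto
    then show "n \<in> {..card (verts G)}" using apath_imp_path_on[OF p(1)] p(2) by simp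
  qed
qed simp

text \<open>A path with \<open>n\<close> arcs has \<open>n + 1\<close> vertices, hence the
  \<open>Suc\<close> in every comparison of a cardinality with a detour distance.\<close>

lemma card_path_on_le:
  assumes "path_on G x A y"
  shows "card A \<le> Suc (detour_dist G x y)"
proof -
  obtain p where p: "apath x p y" "set (awalk_verts x p) = A"
    using assms by (rule path_on_imp_apath)
  then have "length p \<le> detour_dist G x y"
    unfolding detour_dist_def using apath_lengths_finite by (intro Max_ge) auto
  with apath_imp_path_on[OF p(1)] p(2) show ?thesis by simp
qed

lemma detour_path:
  assumes "path_on G x B y"
  obtains A where "path_on G x A y" "card A = Suc (detour_dist G x y)"
proof -
  obtain q where "apath x q y" using assms by (rule path_on_imp_apath)
  then have "detour_dist G x y \<in> {length p |p. apath x p y}"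
    unfolding detour_dist_def using apath_lengths_finite by (intro Max_in) auto
  then obtain p where "apath x p y" "length p = detour_dist G x y" by auto
  with apath_imp_path_on that show thesis by metis
qed

end

locale connected_graph = graph +
  assumes connected: "connected G"
begin

lemma path_on_exists:
  assumes "x \<in> verts G" "y \<in> verts G"
  obtains A where "path_on G x A y"
  using connected assms unfolding connected_iff_linked linked_def by blast

lemma longest_path:
  assumes "x \<in> verts G" "y \<in> verts G"
  obtains A where "path_on G x A y" "card A = Suc (detour_dist G x y)"
  using assms path_on_exists detour_path by metis

lemma detour_dist_leI:
  assumes "x \<in> verts G" "y \<in> verts G" "\<And>A. path_on G x A y \<Longrightarrow> card A \<le> Suc n"
  shows "detour_dist G x y \<le> n"
proof -
  obtain A where "path_on G x A y" "card A = Suc (detour_dist G x y)"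
    using assms(1,2) by (rule longest_path)
  with assms(3) show ?thesis by fastforce
qed

lemma detour_dist_sym:
  assumes "x \<in> verts G" "y \<in> verts G"
  shows "detour_dist G x y = detour_dist G y x"
  using assms card_path_on_le path_on_rev by (intro antisym detour_dist_leI) simp_all

lemma detour_dist_self:
  assumes "x \<in> verts G"
  shows "detour_dist G x x = 0"
proof -
  have "card A \<le> Suc 0" if "path_on G x A x" for A
    using that by (cases rule: path_on.cases) (auto dest: path_on_ends)
  then have "detour_dist G x x \<le> 0" using assms by (intro detour_dist_leI)
  then show ?thesis by simp
qed

lemma detour_dist_pos:
  assumes "x \<in> verts G" "y \<in> verts G" "x \<noteq> y"
  shows "detour_dist G x y \<ge> 1"
proof -
  obtain A where A: "path_on G x A y" using assms(1,2) by (rule path_on_exists)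
  have "card {x, y} \<le> card A"
    using path_on_ends[OF A] by (intro card_mono[OF path_on_finite[OF A]]) auto
  with card_path_on_le[OF A] assms(3) show ?thesis by simp
qed

lemma detour_dist_less_card:
  assumes "x \<in> verts G" "y \<in> verts G"
  shows "detour_dist G x y < card (verts G)"
proof -
  obtain A where A: "path_on G x A y" "card A = Suc (detour_dist G x y)"
    using assms by (rule longest_path)
  then show ?thesis using card_mono[OF finite_verts path_on_verts[OF A(1)]] by simp
qed

text \<open>For longest paths it is not enough to glue paths at \<open>y\<close>: an arbitrary path
  from \<open>x\<close> to \<open>z\<close> has to be bounded. It is cut into two pieces, each of
  which extends to a path ending or starting in \<open>y\<close>; the cut vertex is counted in
  both.\<close>

lemma detour_dist_triangle:
  assumes "x \<in> verts G" "y \<in> verts G" "z \<in> verts G"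
  shows "detour_dist G x z \<le> detour_dist G x y + detour_dist G y z"
proof (rule detour_dist_leI[OF assms(1,3)])
  fix A assume A: "path_on G x A z"
  obtain Q where Q: "path_on G y Q x" using assms(2,1) by (rule path_on_exists)
  \<comment> \<open>Both halves of the \<open>x\<close>-\<open>z\<close> path are prolonged along a path from its first hit \<open>h\<close> to \<open>y\<close>.\<close>
  obtain h P where P: "path_on G y P h" "P \<inter> A = {h}"
    using path_on_first_hit[OF Q, of A] path_on_ends[OF A] by metis
  have "h \<in> A" using P(2) by auto
  then obtain B C where BC: "path_on G x B h" "path_on G h C z" "B \<union> C = A" "B \<inter> C = {h}"
    using path_on_split[OF A] by metis
  have B: "path_on G x (B \<union> P) y"
    using BC(1) path_on_rev[OF P(1)]
    by (rule path_on_concat) (use BC P path_on_ends[OF P(1)] in auto)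
  have C: "path_on G y (P \<union> C) z"
    using P(1) BC(2)
    by (rule path_on_concat) (use BC P path_on_ends[OF P(1)] in auto)
  have "card B \<le> Suc (detour_dist G x y)"
    using card_mono[OF path_on_finite[OF B], of B] card_path_on_le[OF B] by simp
  moreover have "card C \<le> Suc (detour_dist G y z)"
    using card_mono[OF path_on_finite[OF C], of C] card_path_on_le[OF C] by simp
  moreover have "Suc (card A) = card B + card C"
    using card_Un_Int[OF path_on_finite[OF BC(1)] path_on_finite[OF BC(2)]] BC(3,4) by simp
  ultimately show "card A \<le> Suc (detour_dist G x y + detour_dist G y z)" by simp
qed

lemma separates_end [simp]: "separates G x x y" "separates G y x y"
  unfolding separates_def by (auto dest: path_on_ends)

text \<open>A longest path into \<open>y\<close> and a longest path out of \<open>y\<close> meet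
  only in \<open>y\<close>: switching from one to the other at another common vertex would lead from
  \<open>x\<close> to \<open>z\<close> around \<open>y\<close>. Hence their union is a path, and the
  triangle inequality becomes an equality.\<close>

lemma detour_dist_separates:
  assumes "x \<in> verts G" "y \<in> verts G" "z \<in> verts G" "separates G y x z"
  shows "detour_dist G x z = detour_dist G x y + detour_dist G y z"
proof (rule antisym[OF detour_dist_triangle[OF assms(1-3)]])
  obtain A where A: "path_on G x A y" "card A = Suc (detour_dist G x y)"
    using assms(1,2) by (rule longest_path)
  obtain B where B: "path_on G y B z" "card B = Suc (detour_dist G y z)"
    using assms(2,3) by (rule longest_path)
  have AB: "A \<inter> B = {y}"
  proof (rule ccontr)
    assume "A \<inter> B \<noteq> {y}"
    then obtain t where t: "t \<in> A" "t \<in> B" "t \<noteq> y"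
      using path_on_ends[OF A(1)] path_on_ends[OF B(1)] by auto
    obtain A1 A2 where A1: "path_on G x A1 t" "path_on G t A2 y" "A1 \<inter> A2 = {t}"
      using path_on_split[OF A(1) t(1)] by metis
    obtain B1 B2 where B1: "path_on G y B1 t" "path_on G t B2 z" "B1 \<inter> B2 = {t}"
      using path_on_split[OF B(1) t(2)] by metis
    have "y \<notin> A1" using A1(3) path_on_ends[OF A1(2)] t(3) by auto
    moreover have "y \<notin> B2" using B1(3) path_on_ends[OF B1(1)] t(3) by auto
    moreover obtain C where "path_on G x C z" "C \<subseteq> A1 \<union> B2"
      using A1(1) B1(2) by (rule path_on_trans)
    ultimately show False using assms(4) by (auto simp: separates_def)
  qed
  have "path_on G x (A \<union> B) z" using A(1) B(1) AB by (rule path_on_concat)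
  then have "card (A \<union> B) \<le> Suc (detour_dist G x z)" by (rule card_path_on_le)
  moreover have "Suc (card (A \<union> B)) = card A + card B"
    using card_Un_Int[OF path_on_finite[OF A(1)] path_on_finite[OF B(1)]] AB by simp
  ultimately show "detour_dist G x y + detour_dist G y z \<le> detour_dist G x z"
    using A(2) B(2) by simp
qed

section \<open>Detour eccentricity, detour center and levels\<close>

lemma finite_detour_central: "finite (detour_central G)"
  by (simp add: detour_central_def)

lemma detour_central_verts: "w \<in> detour_central G \<Longrightarrow> w \<in> verts G"
  by (simp add: detour_central_def)

lemma verts_nonempty: "verts G \<noteq> {}"
  using connected by (simp add: connected_iff_linked)

lemma detour_central_nonempty: "detour_central G \<noteq> {}"
proof -
  have "Min (detour_ecc G ` verts G) \<in> detour_ecc G ` verts G"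
    using verts_nonempty by (intro Min_in) auto
  then show ?thesis by (auto simp: detour_central_def)
qed

lemma omega_eq: "omega G = card (detour_central G)"
  by (simp add: omega_def detour_center_def)

lemma detour_dist_le_ecc: "x \<in> verts G \<Longrightarrow> detour_dist G v x \<le> detour_ecc G v"
  unfolding detour_ecc_def by (intro Max_ge) auto

lemma detour_ecc_attained:
  obtains x where "x \<in> verts G" "detour_dist G v x = detour_ecc G v"
proof -
  have "detour_ecc G v \<in> detour_dist G v ` verts G"
    unfolding detour_ecc_def using verts_nonempty by (intro Max_in) auto
  with that show thesis by auto
qed

lemma detour_ecc_central_le:
  "w \<in> detour_central G \<Longrightarrow> v \<in> verts G \<Longrightarrow> detour_ecc G w \<le> detour_ecc G v"
  by (simp add: detour_central_def)

lemma detour_centralI: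
  assumes "w \<in> detour_central G" "v \<in> verts G" "detour_ecc G v \<le> detour_ecc G w"
  shows "v \<in> detour_central G"
  using assms order_antisym[OF assms(3) detour_ecc_central_le[OF assms(1,2)]]
  by (simp add: detour_central_def)

lemma level_le: "w \<in> detour_central G \<Longrightarrow> level G v \<le> detour_dist G w v"
  unfolding level_def using finite_detour_central by (intro Min_le) auto

lemma level_attained:
  obtains w where "w \<in> detour_central G" "level G v = detour_dist G w v"
proof -
  have "level G v \<in> (\<lambda>w. detour_dist G w v) ` detour_central G"
    unfolding level_def using finite_detour_central detour_central_nonempty by (intro Min_in) auto
  with that show thesis by auto
qed

text \<open>Let \<open>x\<close> be farthest from \<open>z\<close>. If \<open>z\<close> separated a
  central vertex from \<open>x\<close>, additivity would give that vertex a larger eccentricity than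
  \<open>z\<close>, against minimality. So both central vertices lie on the side of \<open>x\<close>
  after the deletion of \<open>z\<close>.\<close>

lemma central_not_separated:
  assumes "w \<in> detour_central G" "w' \<in> detour_central G" "z \<in> verts G" "z \<noteq> w" "z \<noteq> w'"
  shows "\<not> separates G z w w'"
proof
  assume sep: "separates G z w w'"
  have no: "\<not> separates G z a x"
    if a: "a \<in> detour_central G" "z \<noteq> a" and x: "x \<in> verts G" "detour_dist G z x = detour_ecc G z"
    for a x
  proof
    have aV: "a \<in> verts G" using a(1) by (rule detour_central_verts)
    assume "separates G z a x"
    then have "detour_dist G a x = detour_dist G a z + detour_ecc G z"
      using detour_dist_separates[OF aV assms(3) x(1)] x(2) by simp
    then show False
      using detour_dist_pos[OF aV assms(3)] a(2) detour_dist_le_ecc[OF x(1), of a]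
        detour_ecc_central_le[OF a(1) assms(3)] by simp
  qed
  obtain x where "x \<in> verts G" "detour_dist G z x = detour_ecc G z" by (rule detour_ecc_attained)
  then have "\<not> separates G z w x" "\<not> separates G z x w'"
    using no assms separates_sym by auto
  with sep not_separates_trans show False by blast
qed

end


section \<open>Block graphs\<close>

locale complete_blocks = connected_graph +
  assumes block_complete: "is_block G B \<Longrightarrow> complete_digraph (card (verts B)) B"
begin

lemma block_verts: "is_block G B \<Longrightarrow> verts B \<subseteq> verts G"
  using block_nonsep by (simp add: nonsep_def)

lemma block_adj:
  assumes "is_block G B" "x \<in> verts B" "y \<in> verts B" "x \<noteq> y"
  shows "x \<rightarrow>\<^bsub>G\<^esub> y"
proof -
  have "subgraph B G" using assms(1) by (simp add: is_block_def max_subgraph_def)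
  moreover have "(x, y) \<in> arcs_ends B"
    using block_complete[OF assms(1)] assms(2-) by (simp add: complete_digraph_def)
  ultimately show ?thesis using arcs_ends_mono by auto
qed

text \<open>The gate \<open>y\<close> is the first vertex of \<open>C\<close> on some path from
  \<open>v\<close>. A path from \<open>v\<close> to another vertex \<open>c\<close> of
  \<open>C\<close> around \<open>y\<close> would close a cycle through the edge from
  \<open>y\<close> to \<open>c\<close>; the block of that cycle shares two vertices with
  \<open>C\<close>, hence has the same vertices.\<close>

lemma block_gate:
  assumes "is_block G C" "v \<in> verts G"
  obtains y where "y \<in> verts C" "\<And>c. c \<in> verts C \<Longrightarrow> separates G y v c"
proof -
  obtain c0 where c0: "c0 \<in> verts C"
    using block_nonsep[OF assms(1)] by (auto simp: nonsep_def)
  then have "c0 \<in> verts G" using block_verts[OF assms(1)] by auto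
  with assms(2) obtain A where "path_on G v A c0" by (rule path_on_exists)
  then obtain y P where P: "path_on G v P y" "P \<inter> verts C = {y}"
    using path_on_first_hit[OF _ c0] by metis
  have y: "y \<in> verts C" using P(2) by auto
  have "separates G y v c" if c: "c \<in> verts C" for c
  proof (cases "v = y \<or> c = y")
    case False
    \<comment> \<open>\<open>t\<close> is the last vertex before the block is entered, so it lies
      outside \<open>C\<close>; the cycle would force it into \<open>C\<close>.\<close>
    obtain t B where t: "y \<rightarrow>\<^bsub>G\<^esub> t" "path_on G t B v" "y \<notin> B" "P = insert y B"
      using path_on_first_edge[OF path_on_rev[OF P(1)]] False by metis
    have "t \<notin> verts C" using P(2) t(3,4) path_on_ends[OF t(2)] by auto
    show ?thesis
    proof (rule ccontr)
      assume "\<not> separates G y v c"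
      then obtain Q where Q: "path_on G v Q c" "y \<notin> Q" by (auto simp: separates_def)
      obtain R where R: "path_on G t R c" "R \<subseteq> B \<union> Q" using t(2) Q(1) by (rule path_on_trans)
      have "y \<rightarrow>\<^bsub>G\<^esub> c" using block_adj[OF assms(1) y c] False by metis
      moreover have "y \<notin> R" using R(2) t(3) Q(2) by auto
      ultimately obtain B' where B': "is_block G B'" "{y, t, c} \<subseteq> verts B'"
        using cycle_in_block[OF t(1) _ R(1)] by metis
      have "verts C = verts B'"
        using B' y c False by (intro block_unique[OF assms(1) B'(1), of y c]) auto
      with B'(2) \<open>t \<notin> verts C\<close> show False by simp
    qed
  qed auto
  with y that show thesis by metis
qed

lemma detour_dist_block:
  assumes C: "is_block G C" and zy: "z \<in> verts C" "y \<in> verts C" "z \<noteq> y"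
  shows "detour_dist G z y = card (verts C) - 1"
proof (rule antisym)
  have fin: "finite (verts C)" using block_verts[OF C] finite_verts by (rule finite_subset)
  have V: "z \<in> verts G" "y \<in> verts G" using block_verts[OF C] zy by auto
  show "detour_dist G z y \<le> card (verts C) - 1"
  proof (rule detour_dist_leI[OF V])
    fix A assume A: "path_on G z A y"
    have "A \<subseteq> verts C"
    proof
      fix t assume t: "t \<in> A"
      obtain A1 A2 where A12: "path_on G z A1 t" "path_on G t A2 y" "A1 \<inter> A2 = {t}"
        using path_on_split[OF A t] by metis
      have "t \<in> verts G" using path_on_verts[OF A] t by auto
      \<comment> \<open>A path between two vertices of \<open>C\<close> cannot leave
        \<open>C\<close>: the gate of \<open>t\<close> lies on both pieces of the path, and these
        share only \<open>t\<close>.\<close>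
      then obtain g where g: "g \<in> verts C" "\<And>c. c \<in> verts C \<Longrightarrow> separates G g t c"
        using block_gate[OF C] by metis
      have "g \<in> A1" "g \<in> A2"
        using g(2) zy(1,2) A12 path_on_rev by (auto simp: separates_def)
      then have "g = t" using A12(3) by auto
      with g(1) show "t \<in> verts C" by simp
    qed
    then have "card A \<le> card (verts C)" by (rule card_mono[OF fin])
    then show "card A \<le> Suc (card (verts C) - 1)" by simp
  qed
  have "path_on G z (verts C) y"
    using fin block_verts[OF C] zy block_adj[OF C] by (rule path_on_clique)
  then show "card (verts C) - 1 \<le> detour_dist G z y" using card_path_on_le by fastforce
qed

lemma block_of_edge:
  assumes "w \<rightarrow>\<^bsub>G\<^esub> t"
  obtains B where "is_block G B" "w \<in> verts B" "t \<in> verts B"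
proof -
  have "t \<in> verts G" "w \<notin> {t}" using assms adj_in_verts adj_not_same by auto
  \<comment> \<open>The degenerate cycle: both neighbors of \<open>w\<close> are \<open>t\<close>,
    joined by the one-vertex path.\<close>
  then obtain B where "is_block G B" "{w, t, t} \<subseteq> verts B"
    using cycle_in_block[OF assms assms path_on.single] by metis
  with that show thesis by simp
qed

section \<open>The shape of the detour center\<close>

lemma central_in_block:
  assumes "is_block G C" "w \<in> verts C" "w' \<in> verts C" "w \<noteq> w'"
    and "w \<in> detour_central G" "w' \<in> detour_central G" "z \<in> detour_central G"
  shows "z \<in> verts C"
proof -
  have zV: "z \<in> verts G" using assms(7) by (rule detour_central_verts)
  obtain g where g: "g \<in> verts C" "\<And>c. c \<in> verts C \<Longrightarrow> separates G g z c"
    using block_gate[OF assms(1) zV] by metis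
  have gV: "g \<in> verts G" using block_verts[OF assms(1)] g(1) by auto
  \<comment> \<open>At least one of the two central vertices differs from the gate of
    \<open>z\<close>. A gate other than \<open>z\<close> would separate it from the central vertex
    \<open>z\<close>, which is impossible.\<close>
  obtain c where c: "c \<in> {w, w'}" "c \<noteq> g" using assms(4) by (metis insertI1 insertI2)
  then have "\<not> separates G g z c" if "g \<noteq> z"
    using central_not_separated[OF assms(7) _ gV that, of c] assms(5,6) by auto
  moreover have "separates G g z c" using g(2) c(1) assms(2,3) by auto
  ultimately show ?thesis using g(1) by auto
qed

text \<open>Take the block of the first edge of a path from \<open>w\<close> to \<open>w'\<close>.
  The gate of \<open>w'\<close> in it is not \<open>w\<close>, because the rest of the path avoids
  \<open>w\<close>; it separates \<open>w'\<close> from \<open>w\<close>, so it can only be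
  \<open>w'\<close> itself.\<close>

lemma central_pair_in_block:
  assumes w: "w \<in> detour_central G" and w': "w' \<in> detour_central G" and "w \<noteq> w'"
  obtains C where "is_block G C" "w \<in> verts C" "w' \<in> verts C"
proof -
  have V: "w \<in> verts G" "w' \<in> verts G" using w w' detour_central_verts by auto
  then obtain A where "path_on G w A w'" by (rule path_on_exists)
  then obtain t B where t: "w \<rightarrow>\<^bsub>G\<^esub> t" "path_on G t B w'" "w \<notin> B"
    using path_on_first_edge[OF _ assms(3)] by metis
  obtain C where C: "is_block G C" "w \<in> verts C" "t \<in> verts C" using t(1) by (rule block_of_edge)
  obtain g where g: "g \<in> verts C" "\<And>c. c \<in> verts C \<Longrightarrow> separates G g w' c"
    using block_gate[OF C(1) V(2)] by metis
  have "g \<noteq> w" using g(2)[OF C(3)] path_on_rev[OF t(2)] t(3) by (auto simp: separates_def)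
  then have "g = w'"
    using central_not_separated[OF w' w, of g] g(2)[OF C(2)] g(1) block_verts[OF C(1)] by auto
  with C g(1) that show thesis by simp
qed

text \<open>All vertices of the block are central. If \<open>y\<close> is the gate of a vertex
  \<open>x\<close> farthest from \<open>z\<close>, then \<open>w\<close> or \<open>w'\<close>
  differs from \<open>y\<close> and is as far from \<open>y\<close> as any vertex of a complete
  block can be. So it is at least as far from \<open>x\<close> as \<open>z\<close> is.\<close>

lemma central_block:
  assumes w: "w \<in> detour_central G" and w': "w' \<in> detour_central G" and "w \<noteq> w'"
  obtains C where "is_block G C" "verts C = detour_central G"
proof -
  obtain C where C: "is_block G C" "w \<in> verts C" "w' \<in> verts C"
    using assms by (rule central_pair_in_block)
  have "z \<in> detour_central G" if z: "z \<in> verts C" for z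
  proof (rule detour_centralI[OF w])
    show zV: "z \<in> verts G" using block_verts[OF C(1)] z by auto
    obtain x where x: "x \<in> verts G" "detour_dist G z x = detour_ecc G z"
      by (rule detour_ecc_attained)
    obtain y where y: "y \<in> verts C" "\<And>c. c \<in> verts C \<Longrightarrow> separates G y x c"
      using block_gate[OF C(1) x(1)] by metis
    have yV: "y \<in> verts G" using block_verts[OF C(1)] y(1) by auto
    obtain c where c: "c \<in> {w, w'}" "c \<noteq> y" using assms(3) by (metis insertI1 insertI2)
    then have cc: "c \<in> detour_central G" and cC: "c \<in> verts C" using w w' C by auto
    have cV: "c \<in> verts G" using cc by (rule detour_central_verts)
    have "detour_dist G z y \<le> detour_dist G c y"
      using detour_dist_block[OF C(1) z y(1)] detour_dist_block[OF C(1) cC y(1) c(2)]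
        detour_dist_self[OF yV] by (cases "z = y") auto
    moreover have "detour_dist G c x = detour_dist G c y + detour_dist G y x"
      using y(2)[OF cC] separates_sym by (intro detour_dist_separates cV yV x(1)) auto
    ultimately have "detour_dist G z x \<le> detour_dist G c x"
      using detour_dist_triangle[OF zV yV x(1)] by simp
    then show "detour_ecc G z \<le> detour_ecc G w"
      using x detour_dist_le_ecc[OF x(1), of c]
        detour_ecc_central_le[OF cc detour_central_verts[OF w]] by simp
  qed
  then have "verts C = detour_central G"
    using central_in_block[OF C assms(3) w w'] by auto
  with C(1) that show thesis by blast
qed

lemma omega_ge_2D:
  assumes "omega G \<ge> 2"
  obtains C where "is_block G C" "verts C = detour_central G"
proof -
  have "\<not> card (detour_central G) \<le> Suc 0" using assms omega_eq by simp
  then obtain w w' where "w \<in> detour_central G" "w' \<in> detour_central G" "w \<noteq> w'"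
    using card_le_Suc0_iff_eq[OF finite_detour_central] by auto
  then show thesis using central_block that by metis
qed

lemma detour_dist_central:
  assumes "w \<in> detour_central G" "w' \<in> detour_central G" "w \<noteq> w'"
  shows "detour_dist G w w' = omega G - 1"
proof -
  obtain C where "is_block G C" "verts C = detour_central G" using assms by (rule central_block)
  with assms show ?thesis using detour_dist_block[of C w w'] by (simp add: omega_eq)
qed

lemma omega_pos: "omega G \<ge> 1"
  using detour_central_nonempty finite_detour_central by (simp add: omega_eq Suc_le_eq card_gt_0_iff)

text \<open>The route is taken through nearest central vertices of \<open>u\<close> and
  \<open>v\<close>; if these coincide, the middle part is \<open>0\<close>. Truncation in
  \<open>omega G - 1\<close> is harmless because \<open>omega G\<close> is positive.\<close>

lemma detour_dist_le_levels:
  assumes "u \<in> verts G" "v \<in> verts G"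
  shows "detour_dist G u v \<le> level G u + level G v + (omega G - 1)"
proof -
  obtain w where w: "w \<in> detour_central G" "level G u = detour_dist G w u" by (rule level_attained)
  obtain w' where w': "w' \<in> detour_central G" "level G v = detour_dist G w' v" by (rule level_attained)
  have V: "w \<in> verts G" "w' \<in> verts G" using w w' detour_central_verts by auto
  have "detour_dist G w w' \<le> omega G - 1"
    using detour_dist_central[OF w(1) w'(1)] detour_dist_self[OF V(1)] by (cases "w = w'") auto
  moreover have "detour_dist G u v \<le> detour_dist G u w + (detour_dist G w w' + detour_dist G w' v)"
    using detour_dist_triangle[OF assms(1) V(1) assms(2)] detour_dist_triangle[OF V assms(2)] by simp
  ultimately show ?thesis
    using w(2) w'(2) detour_dist_sym[OF assms(1) V(1)] by simp
qed

section \<open>A unique detour central vertex\<close>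

lemma omega_eq_1D:
  assumes "omega G = 1"
  obtains w where "detour_central G = {w}"
  using assms by (auto simp: omega_eq card_1_singleton_iff)

lemma level_unique_center:
  assumes "detour_central G = {w}"
  shows "level G v = detour_dist G w v"
  using level_attained[of v] assms by auto

text \<open>A path from \<open>w\<close> to \<open>v\<close> starts inside some block
  \<open>B\<close> at \<open>w\<close>, and the gate of \<open>v\<close> in \<open>B\<close> is not
  \<open>w\<close>. So the detour from \<open>w\<close> to \<open>v\<close> already spends
  \<open>card (verts B) - 1\<close> arcs inside \<open>B\<close>.\<close>

lemma xi_le_level:
  assumes w: "detour_central G = {w}" and v: "v \<in> verts G" "v \<noteq> w"
  shows "xi G \<le> level G v"
proof -
  have wV: "w \<in> verts G" using w detour_central_verts by auto
  then obtain A where A: "path_on G w A v" using v(1) by (rule path_on_exists)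
  obtain t Q where t: "w \<rightarrow>\<^bsub>G\<^esub> t" "path_on G t Q v" "w \<notin> Q"
    using path_on_first_edge[OF A] v(2) by metis
  obtain B where B: "is_block G B" "w \<in> verts B" "t \<in> verts B" using t(1) by (rule block_of_edge)
  obtain g where g: "g \<in> verts B" "\<And>c. c \<in> verts B \<Longrightarrow> separates G g v c"
    using block_gate[OF B(1) v(1)] by metis
  have gw: "w \<noteq> g" using g(2)[OF B(3)] path_on_rev[OF t(2)] t(3) by (auto simp: separates_def)
  have gV: "g \<in> verts G" using block_verts[OF B(1)] g(1) by auto
  have "detour_dist G w v = detour_dist G w g + detour_dist G g v"
    using detour_dist_separates[OF wV gV v(1)] g(2)[OF B(2)] separates_sym by simp
  then have "card (verts B) - 1 \<le> level G v"
    using detour_dist_block[OF B(1,2) g(1) gw] level_unique_center[OF w] by simp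
  moreover have "xi G \<le> card (verts B) - 1"
  proof -
    have fin: "finite {card (verts B) - 1 |B. is_block G B \<and> detour_central G \<subseteq> verts B}"
      by (rule finite_subset[of _ "{..card (verts G)}"])
        (auto simp: le_diff_conv dest!: block_verts intro!: le_SucI card_mono)
    show ?thesis
      using w B Min_le[OF fin, of "card (verts B) - 1"] by (auto simp: xi_def omega_eq)
  qed
  ultimately show ?thesis by simp
qed

end


section \<open>Branches\<close>

context complete_blocks
begin

text \<open>The first vertex after \<open>w\<close> on a shortest path is an ancestor of
  \<open>u\<close>. The set \<open>B\<close> is quantified last because the suitable block becomes
  known only after the first vertices of two such paths are compared.\<close>

lemma in_branch_via_first_vertex:
  assumes w: "detour_central G = {w}" and u: "u \<in> verts G" "u \<noteq> w"
  obtains x A where "w \<rightarrow>\<^bsub>G\<^esub> x" "path_on G x A u" "w \<notin> A"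
    "\<And>B. x \<in> verts B \<Longrightarrow> u \<in> verts (branch G w B)"
proof -
  have wV: "w \<in> verts G" using w detour_central_verts by auto
  obtain A0 where "path_on G w A0 u" using wV u(1) by (rule path_on_exists)
  then obtain p0 where "apath w p0 u" by (rule path_on_imp_apath)
  then obtain p where p: "apath w p u" "\<And>q. apath w q u \<Longrightarrow> length p \<le> length q"
    using arg_min_nat_lemma[of "\<lambda>p. apath w p u" p0 length] by metis
  have sp: "shortest_path G w p u" using p by (simp add: shortest_path_def)
  have "path_on G w (set (awalk_verts w p)) u" using apath_imp_path_on[OF p(1)] by simp
  then obtain x A where x: "w \<rightarrow>\<^bsub>G\<^esub> x" "path_on G x A u" "w \<notin> A" "set (awalk_verts w p) = insert w A"
    using path_on_first_edge u(2) by metis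
  have xA: "x \<in> A" using path_on_ends[OF x(2)] by simp
  have "nearest_central G w u"
    using w level_unique_center[OF w] by (simp add: nearest_central_def)
  then have "ancestor G x u"
    using sp x(4) xA by (auto simp: ancestor_def)
  moreover have "x \<noteq> w" using xA x(3) by auto
  ultimately have "u \<in> verts (branch G w B)" if "x \<in> verts B" for B
    using that u(1) by (auto simp: branch_def)
  with that x show thesis by metis
qed

text \<open>If \<open>u\<close> and \<open>v\<close> are joined around \<open>w\<close>, so are the
  first vertices \<open>x\<close> and \<open>y\<close> of their paths from \<open>w\<close>. The
  resulting cycle through \<open>w\<close> puts \<open>x\<close> and \<open>y\<close> into one
  block, whose branch contains both \<open>u\<close> and \<open>v\<close>.\<close>

lemma different_branches_separates:
  assumes w: "detour_central G = {w}" and V: "u \<in> verts G" "v \<in> verts G"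
    and "different_branches G u v"
  shows "separates G w u v"
proof (rule ccontr)
  assume ns: "\<not> separates G w u v"
  then have uv: "u \<noteq> w" "v \<noteq> w" by auto
  obtain x A where x: "w \<rightarrow>\<^bsub>G\<^esub> x" "path_on G x A u" "w \<notin> A"
    "\<And>B. x \<in> verts B \<Longrightarrow> u \<in> verts (branch G w B)"
    using in_branch_via_first_vertex[OF w V(1) uv(1)] by metis
  obtain y B where y: "w \<rightarrow>\<^bsub>G\<^esub> y" "path_on G y B v" "w \<notin> B"
    "\<And>B. y \<in> verts B \<Longrightarrow> v \<in> verts (branch G w B)"
    using in_branch_via_first_vertex[OF w V(2) uv(2)] by metis
  have "\<not> separates G w x u" "\<not> separates G w v y"
    using x(2,3) path_on_rev[OF y(2)] y(3) by (auto simp: separates_def)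
  then have "\<not> separates G w x y"
    using ns not_separates_trans[of w x u v] not_separates_trans[of w x v y] by simp
  then obtain Q where Q: "path_on G x Q y" "w \<notin> Q" by (auto simp: separates_def)
  obtain C where C: "is_block G C" "{w, x, y} \<subseteq> verts C"
    using x(1) y(1) Q by (rule cycle_in_block)
  then have "is_branch_at G w (branch G w C)" using w by (auto simp: is_branch_at_def)
  moreover have "u \<in> verts (branch G w C)" "v \<in> verts (branch G w C)" using x(4) y(4) C(2) by auto
  ultimately show False using assms(4) by (auto simp: different_branches_def)
qed

lemma detour_dist_different_branches:
  assumes "omega G = 1" "u \<in> verts G" "v \<in> verts G" "different_branches G u v"
  shows "detour_dist G u v = level G u + level G v"
proof -
  obtain w where w: "detour_central G = {w}" using assms(1) by (rule omega_eq_1D)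
  then have wV: "w \<in> verts G" using detour_central_verts by auto
  show ?thesis
    using detour_dist_separates[OF assms(2) wV assms(3) different_branches_separates[OF w assms(2-)]]
      level_unique_center[OF w] detour_dist_sym[OF wV assms(2)] by simp
qed

text \<open>A vertex of the branch is joined around \<open>w\<close> to a vertex \<open>x\<close> of
  its block \<open>B\<close>, so it suffices that \<open>w\<close> separates \<open>x\<close> from
  the other central vertices.\<close>

lemma associated_separates:
  assumes C: "is_block G C" "verts C = detour_central G"
    and "associated G w u" and c: "c \<in> verts C" "c \<noteq> w"
  shows "separates G w u c"
proof (cases "u = w")
  case False
  have wC: "w \<in> verts C" using assms(3) C(2) by (simp add: associated_def)
  from assms(3) False obtain B where B: "is_block G B" "verts B \<inter> verts C = {w}"
    and u: "u \<in> verts (branch G w B)"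
    by (auto simp: associated_def is_branch_at_def C(2))
  \<comment> \<open>Otherwise a cycle through \<open>w\<close>, \<open>x\<close> and
    \<open>c'\<close> would lie in a block sharing two vertices with \<open>B\<close> and two with
    \<open>C\<close>, which identifies \<open>B\<close> and \<open>C\<close>.\<close>
  have sepB: "separates G w x c'" if x: "x \<in> verts B - {w}" and c': "c' \<in> verts C - {w}" for x c'
  proof (rule ccontr)
    assume "\<not> separates G w x c'"
    then obtain A where A: "path_on G x A c'" "w \<notin> A" by (auto simp: separates_def)
    have wB: "w \<in> verts B" using B(2) by auto
    have "w \<rightarrow>\<^bsub>G\<^esub> x" "w \<rightarrow>\<^bsub>G\<^esub> c'"
      using block_adj[OF B(1) wB, of x] block_adj[OF C(1) wC, of c'] x c' by auto
    then obtain D where D: "is_block G D" "{w, x, c'} \<subseteq> verts D"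
      using A by (rule cycle_in_block)
    have "verts B = verts D"
      using x wB D(2) by (intro block_unique[OF B(1) D(1), of w x]) auto
    moreover have "verts C = verts D"
      using c' wC D(2) by (intro block_unique[OF C(1) D(1), of w c']) auto
    ultimately show False using B(2) x by auto
  qed
  show ?thesis
  proof (cases "u \<in> verts B")
    case True
    with False c show ?thesis by (intro sepB) auto
  next
    case uB: False
    then obtain x where x: "x \<in> verts B - {w}" "ancestor G x u"
      using u by (auto simp: branch_def)
    then obtain w2 p where p: "w2 \<in> verts C" "apath w2 p u" "x \<in> set (awalk_verts w2 p)"
      by (auto simp: ancestor_def nearest_central_def shortest_path_def C(2))
    obtain P Q where PQ: "path_on G w2 P x" "path_on G x Q u" "P \<inter> Q = {x}"
      using path_on_split[OF conjunct1[OF apath_imp_path_on[OF p(2)]] p(3)] by metis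
    \<comment> \<open>Whichever central vertex the shortest path starts from, it meets
      \<open>w\<close> before \<open>x\<close>; therefore its remaining part from \<open>x\<close>
      to \<open>u\<close> avoids \<open>w\<close>.\<close>
    have "w \<in> P"
    proof (cases "w2 = w")
      case True
      then show ?thesis using path_on_ends[OF PQ(1)] by simp
    next
      case False
      with sepB[OF x(1)] p(1) have "separates G w x w2" by simp
      with path_on_rev[OF PQ(1)] show ?thesis by (auto simp: separates_def)
    qed
    then have "w \<notin> Q" using PQ(3) x(1) by auto
    then have "\<not> separates G w x u" using PQ(2) by (auto simp: separates_def)
    moreover have "separates G w x c" using sepB[OF x(1)] c by simp
    ultimately show ?thesis using not_separates_trans by metis
  qed
qed simp

text \<open>Association is defined by branches and not by nearness. It still determines a nearest
  central vertex, because detours from every other central vertex to \<open>u\<close> pass through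
  \<open>w\<close>.\<close>

lemma level_associated:
  assumes C: "is_block G C" "verts C = detour_central G"
    and u: "u \<in> verts G" "associated G w u"
  shows "level G u = detour_dist G w u"
proof (rule antisym)
  have w: "w \<in> detour_central G" using u(2) by (simp add: associated_def)
  then show "level G u \<le> detour_dist G w u" by (rule level_le)
  obtain c where c: "c \<in> detour_central G" "level G u = detour_dist G c u" by (rule level_attained)
  have V: "c \<in> verts G" "w \<in> verts G" using w c(1) detour_central_verts by auto
  show "detour_dist G w u \<le> level G u"
  proof (cases "c = w")
    case False
    then have "separates G w c u"
      using associated_separates[OF C u(2), of c] c(1) C(2) separates_sym by simp
    then show ?thesis using detour_dist_separates[OF V u(1)] c(2) by simp
  qed (use c(2) in simp)
qed

lemma detour_dist_opposite_branches:
  assumes "omega G \<ge> 2" and V: "u \<in> verts G" "v \<in> verts G" and "opposite_branches G u v"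
  shows "detour_dist G u v = level G u + level G v + (omega G - 1)"
proof -
  obtain C where C: "is_block G C" "verts C = detour_central G"
    using assms(1) by (rule omega_ge_2D)
  obtain w w' where ww: "w \<noteq> w'" "associated G w u" "associated G w' v"
    using assms(4) by (auto simp: opposite_branches_def)
  then have wC: "w \<in> verts C" "w' \<in> verts C" by (auto simp: associated_def C(2))
  then have wV: "w \<in> verts G" "w' \<in> verts G" using block_verts[OF C(1)] by auto
  have u: "separates G w u w'" using associated_separates[OF C ww(2) wC(2)] ww(1) by simp
  have v: "separates G w' v w" using associated_separates[OF C ww(3) wC(1)] ww(1) by simp
  \<comment> \<open>Cut a path from \<open>v\<close> to \<open>w\<close> at \<open>w'\<close>, which
    it has to contain; its first part avoids \<open>w\<close>. Since \<open>w\<close> separates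
    \<open>u\<close> from \<open>w'\<close>, it then also separates \<open>u\<close> from
    \<open>v\<close>.\<close>
  have "\<not> separates G w v w'"
  proof -
    obtain R where R: "path_on G v R w" using V(2) wV(1) by (rule path_on_exists)
    then have "w' \<in> R" using v by (simp add: separates_def)
    then obtain R1 R2 where R12: "path_on G v R1 w'" "path_on G w' R2 w" "R1 \<inter> R2 = {w'}"
      using path_on_split[OF R] by metis
    have "w \<notin> R1" using R12(3) path_on_ends[OF R12(2)] ww(1) by auto
    with R12(1) show ?thesis by (auto simp: separates_def)
  qed
  with u have "separates G w u v" using not_separates_trans by metis
  then have "detour_dist G u v = detour_dist G u w + detour_dist G w v"
    by (rule detour_dist_separates[OF V(1) wV(1) V(2)])
  also have "detour_dist G w v = detour_dist G w w' + detour_dist G w' v"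
    using v separates_sym by (intro detour_dist_separates wV V(2)) simp
  also have "detour_dist G w w' = omega G - 1"
    using wC ww(1) C(2) by (intro detour_dist_central) auto
  finally show ?thesis
    using level_associated[OF C V(1) ww(2)] level_associated[OF C V(2) ww(3)]
      detour_dist_sym[OF V(1) wV(1)] by simp
qed

end

lemma block_graph_complete_blocks: "block_graph G \<Longrightarrow> complete_blocks G"
  by (simp add: block_graph_def complete_blocks_def complete_blocks_axioms_def
      connected_graph_def connected_graph_axioms_def)

section \<open>Hamiltonian colorings\<close>

lemma sum_consecutive:
  fixes f :: "nat \<Rightarrow> int"
  shows "(\<Sum>i<n. f i + f (Suc i)) = 2 * (\<Sum>i<Suc n. f i) - f 0 - f n"
  by (induction n) auto

lemma hc_coloring_ge:
  assumes "finite (verts G)" "v \<in> verts G"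
  shows "c v \<le> hc_coloring G c"
  using assms by (simp add: hc_coloring_def)

context complete_blocks
begin

text \<open>Each level occurs in two gaps except those of the first and last vertex. The closed form
  serves both bounds: for the vertices sorted by color and for the given ordering.\<close>

lemma sum_gaps:
  assumes "bij_betw x {..<card (verts G)} (verts G)"
  shows "(\<Sum>i<card (verts G) - 1. int (card (verts G)) - int (omega G)
        - int (level G (x i)) - int (level G (x (Suc i))))
    = (int (card (verts G)) - 1) * (int (card (verts G)) - int (omega G)) - 2 * int (total_level G)
      + int (level G (x 0)) + int (level G (x (card (verts G) - 1)))"
proof -
  let ?p = "card (verts G)" and ?f = "\<lambda>i. int (level G (x i))"
  have p: "?p \<ge> 1" using verts_nonempty by (simp add: Suc_le_eq card_gt_0_iff)
  have "(\<Sum>i<?p - 1. int ?p - int (omega G) - ?f i - ?f (Suc i))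
      = (\<Sum>i<?p - 1. int ?p - int (omega G)) - (\<Sum>i<?p - 1. ?f i + ?f (Suc i))"
    by (simp add: sum_subtractf sum.distrib)
  also have "(\<Sum>i<?p - 1. int ?p - int (omega G)) = (int ?p - 1) * (int ?p - int (omega G))"
    using p by (simp add: of_nat_diff)
  also have "(\<Sum>i<?p - 1. ?f i + ?f (Suc i)) = 2 * (\<Sum>i<?p. ?f i) - ?f 0 - ?f (?p - 1)"
    using sum_consecutive[of ?f "?p - 1"] p by simp
  also have "(\<Sum>i<?p. ?f i) = int (total_level G)"
    unfolding total_level_def using sum.reindex_bij_betw[OF assms, of "\<lambda>v. int (level G v)"] by simp
  finally show ?thesis by simp
qed

text \<open>The value \<open>xi G\<close> comes from the levels of the two extreme vertices. For a
  single vertex these coincide and may both be the center; the assumption \<open>small\<close>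
  covers that case.\<close>

lemma hc_coloring_lower_bound:
  assumes c: "hamiltonian_coloring G c"
    and small: "card (verts G) = 1 \<Longrightarrow> int (xi G) \<le> 0"
  shows "(int (card (verts G)) - 1) * (int (card (verts G)) - int (omega G))
      - 2 * int (total_level G) + int (xi G) \<le> int (hc_coloring G c)"
proof -
  let ?p = "card (verts G)"
  have p: "?p \<ge> 1" using verts_nonempty by (simp add: Suc_le_eq card_gt_0_iff)
  obtain ys where ys: "set ys = verts G" "distinct ys" using finite_distinct_list finite_verts by metis
  \<comment> \<open>Sorting by color removes the absolute values from the coloring condition, so
    that the sum of the gaps telescopes.\<close>
  define xs where "xs = sort_key c ys"
  have xs: "set xs = verts G" "distinct xs" "sorted (map c xs)" using ys by (simp_all add: xs_def)
  have len: "length xs = ?p" using xs(1,2) distinct_card by metis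
  define x where "x = (\<lambda>i. xs ! i)"
  have bij: "bij_betw x {..<?p} (verts G)"
    using bij_betw_nth[OF xs(2)] len xs(1) by (simp add: x_def)
  have xV: "x i \<in> verts G" if "i < ?p" for i using that bij_betwE[OF bij] by simp
  have step: "int ?p - int (omega G) - int (level G (x i)) - int (level G (x (Suc i)))
      \<le> int (c (x (Suc i))) - int (c (x i))" if i: "Suc i < ?p" for i
  proof -
    have V: "x i \<in> verts G" "x (Suc i) \<in> verts G" using xV i by simp_all
    have "c (x i) \<le> c (x (Suc i))"
      using xs(3) i len sorted_nth_mono[of "map c xs" i "Suc i"] by (simp add: x_def)
    moreover have "x i \<noteq> x (Suc i)" using nth_eq_iff_index_eq[OF xs(2)] i len by (simp add: x_def)
    then have "int (detour_dist G (x i) (x (Suc i))) + \<bar>int (c (x i)) - int (c (x (Suc i)))\<bar> \<ge> int ?p - 1"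
      using c V unfolding hamiltonian_coloring_def by blast
    ultimately show ?thesis
      using detour_dist_le_levels[OF V] omega_pos by linarith
  qed
  have "int (xi G) \<le> int (level G (x 0)) + int (level G (x (?p - 1)))"
  proof (cases "omega G = 1 \<and> ?p \<noteq> 1")
    case True
    then obtain w where w: "detour_central G = {w}" using omega_eq_1D by metis
    \<comment> \<open>Two distinct extreme vertices cannot both be the unique center, and the one
      that is not has level at least \<open>xi G\<close>.\<close>
    have "x 0 \<noteq> x (?p - 1)"
      using True p bij_betw_imp_inj_on[OF bij] by (auto dest: inj_onD[of x _ 0 "?p - 1"])
    then have "x 0 \<noteq> w \<or> x (?p - 1) \<noteq> w" by metis
    then have "xi G \<le> level G (x 0) \<or> xi G \<le> level G (x (?p - 1))"
      using xi_le_level[OF w] xV[of 0] xV[of "?p - 1"] p by auto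
    then show ?thesis by linarith
  next
    case False
    then show ?thesis using small by (cases "omega G = 1") (auto simp: xi_def)
  qed
  moreover have "(\<Sum>i<?p - 1. int ?p - int (omega G) - int (level G (x i)) - int (level G (x (Suc i))))
      \<le> (\<Sum>i<?p - 1. int (c (x (Suc i))) - int (c (x i)))"
    by (intro sum_mono step) auto
  moreover have "(\<Sum>i<?p - 1. int (c (x (Suc i))) - int (c (x i))) = int (c (x (?p - 1))) - int (c (x 0))"
    using sum_lessThan_telescope[of "\<lambda>i. int (c (x i))"] by simp
  moreover have "c (x (?p - 1)) \<le> hc_coloring G c"
    using xV p by (intro hc_coloring_ge) auto
  ultimately show ?thesis using sum_gaps[OF bij] by simp
qed

end

section \<open>The coloring defined by the recurrence\<close>

lemma follows_recurrence_exists: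
  fixes G :: "('a, 'b) pre_digraph" and u :: "nat \<Rightarrow> 'a"
  assumes "card (verts G) > 0" and inj: "inj_on u {..<card (verts G)}"
    and nonneg: "\<And>i. i + 1 < card (verts G) \<Longrightarrow>
      int (level G (u i)) + int (level G (u (i + 1))) + int (omega G) \<le> int (card (verts G))"
  shows "\<exists>c. follows_recurrence G u c"
proof -
  let ?p = "card (verts G)"
  define d where "d = (\<lambda>i. int ?p - int (level G (u i)) - int (level G (u (i + 1))) - int (omega G))"
  \<comment> \<open>The color of a vertex is the partial sum of the increments up to its index. All
    increments are nonnegative by \<open>nonneg\<close>, so \<open>nat\<close> truncates nothing on
    the vertices.\<close>
  define c where "c = (\<lambda>v. nat (\<Sum>i<the_inv_into {..<?p} u v. d i))"
  have c: "int (c (u i)) = (\<Sum>j<i. d j)" if i: "i < ?p" for i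
  proof -
    have "(\<Sum>j<i. d j) \<ge> 0"
    proof (rule sum_nonneg)
      fix j assume "j \<in> {..<i}"
      with nonneg[of j] i show "d j \<ge> 0" by (simp add: d_def)
    qed
    with i show ?thesis by (simp add: c_def the_inv_into_f_f[OF inj])
  qed
  have "c (u 0) = 0" using c[of 0] assms(1) by simp
  then have "follows_recurrence G u c"
    using c by (auto simp: follows_recurrence_def d_def)
  then show ?thesis by (rule exI[of _ c])
qed

context complete_blocks
begin

text \<open>By \<open>dist\<close>, each increment is \<open>p - 1\<close> minus the detour distance
  of the two vertices, hence nonnegative. So colors never decrease along the ordering, and the
  largest color is the last one.\<close>

lemma recurrence_properties:
  assumes bij: "bij_betw u {..<card (verts G)} (verts G)"
    and dist: "\<And>i. i + 1 < card (verts G) \<Longrightarrow>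
      int (detour_dist G (u i) (u (i + 1))) = int (level G (u i)) + int (level G (u (i + 1))) + int (omega G) - 1"
    and half: "\<And>i. i + 1 < card (verts G) \<Longrightarrow> 2 * detour_dist G (u i) (u (i + 1)) \<le> card (verts G)"
    and c: "follows_recurrence G u c"
  shows "hamiltonian_coloring G c"
    and "int (hc_coloring G c) = (\<Sum>i<card (verts G) - 1. int (card (verts G)) - int (omega G)
        - int (level G (u i)) - int (level G (u (Suc i))))"
proof -
  let ?p = "card (verts G)"
  have p: "?p \<ge> 1" using verts_nonempty by (simp add: Suc_le_eq card_gt_0_iff)
  have uV: "u i \<in> verts G" if "i < ?p" for i using that bij_betwE[OF bij] by simp
  have c0: "c (u 0) = 0" using c by (simp add: follows_recurrence_def)
  have step: "int (c (u (Suc i))) = int (c (u i)) + (int ?p - int (omega G)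
        - int (level G (u i)) - int (level G (u (Suc i))))" if "Suc i < ?p" for i
    using c that by (auto simp: follows_recurrence_def)
  then have gap: "int (c (u (Suc i))) - int (c (u i)) = int ?p - 1 - int (detour_dist G (u i) (u (Suc i)))"
    if "Suc i < ?p" for i
    using dist[of i] that by simp
  have less: "detour_dist G (u i) (u j) < ?p" if "i < ?p" "j < ?p" for i j
    using uV that by (intro detour_dist_less_card)
  have mono1: "c (u i) \<le> c (u (Suc i))" if "Suc i < ?p" for i
    using gap[OF that] less[of i "Suc i"] that by simp
  have mono: "i \<le> j \<Longrightarrow> j < ?p \<Longrightarrow> c (u i) \<le> c (u j)" for i j
  proof (induction j rule: dec_induct)
    case (step j)
    then show ?case using mono1[of j] by simp
  qed simp
  have far: "int (detour_dist G (u i) (u j)) + (int (c (u j)) - int (c (u i))) \<ge> int ?p - 1"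
    if ij: "i < j" "j < ?p" for i j
  proof (cases "j = Suc i")
    case True
    then show ?thesis using gap[of i] ij by simp
  next
    case False
    \<comment> \<open>Two consecutive steps already climb \<open>2(p - 1) - p\<close>.\<close>
    then have j: "Suc (Suc i) \<le> j" using ij by simp
    have "u i \<noteq> u j"
      using bij_betw_imp_inj_on[OF bij] ij by (auto dest: inj_onD[of u _ i j])
    \<comment> \<open>The climb over two steps is at least \<open>p - 2\<close>; distinctness of the
      vertices supplies the missing \<open>1\<close>.\<close>
    then have "detour_dist G (u i) (u j) \<ge> 1" using uV ij by (intro detour_dist_pos) auto
    moreover have "int (c (u (Suc (Suc i)))) \<le> int (c (u j))" using mono[OF j ij(2)] by simp
    ultimately show ?thesis
      using gap[of i] gap[of "Suc i"] half[of i] half[of "Suc i"] j ij by simp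
  qed
  show "hamiltonian_coloring G c"
    unfolding hamiltonian_coloring_def
  proof (intro ballI impI)
    fix a b assume ab: "a \<in> verts G" "b \<in> verts G" "a \<noteq> b"
    obtain i where i: "i < ?p" "a = u i" using bij ab(1) by (auto simp: bij_betw_def)
    obtain j where j: "j < ?p" "b = u j" using bij ab(2) by (auto simp: bij_betw_def)
    have "i \<noteq> j" using i j ab(3) by auto
    then show "int ?p - 1 \<le> int (detour_dist G a b) + \<bar>int (c a) - int (c b)\<bar>"
      using far[of i j] far[of j i] i j detour_dist_sym[OF ab(1,2)] by (cases "i < j") auto
  qed
  have "int (c (u n)) = (\<Sum>i<n. int ?p - int (omega G) - int (level G (u i)) - int (level G (u (Suc i))))"
    if "n < ?p" for n
    using that by (induction n) (simp_all add: c0 step)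
  moreover have "hc_coloring G c = c (u (?p - 1))"
    unfolding hc_coloring_def
  proof (rule Max_eqI)
    fix y assume "y \<in> c ` verts G"
    then obtain v where v: "v \<in> verts G" "y = c v" by auto
    then have "v \<in> u ` {..<?p}" using bij by (simp add: bij_betw_def)
    with v(2) obtain i where "i < ?p" "y = c (u i)" by auto
    then show "y \<le> c (u (?p - 1))" using mono[of i "?p - 1"] by simp
  qed (use uV p in auto)
  ultimately show "int (hc_coloring G c) = (\<Sum>i<?p - 1. int ?p - int (omega G)
        - int (level G (u i)) - int (level G (u (Suc i))))"
    using p by simp
qed

end

theorem theorem2:
  fixes G :: "('a, 'b) pre_digraph" and u :: "nat \<Rightarrow> 'a" and p :: nat
  assumes "block_graph G"
    and "p = card (verts G)"
    and "bij_betw u {..<p} (verts G)"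
    and "omega G = 1 \<Longrightarrow> level G (u 0) = 0 \<and> level G (u (p - 1)) = xi G"
    and "omega G \<ge> 2 \<Longrightarrow> level G (u 0) = 0 \<and> level G (u (p - 1)) = 0"
    and "\<And>i. omega G = 1 \<Longrightarrow> i + 1 < p \<Longrightarrow> different_branches G (u i) (u (i + 1))"
    and "\<And>i. omega G \<ge> 2 \<Longrightarrow> i + 1 < p \<Longrightarrow> opposite_branches G (u i) (u (i + 1))"
    and "\<And>i. i + 1 < p \<Longrightarrow> real (detour_dist G (u i) (u (i + 1))) \<le> real p / 2"
  shows "int (hc G) = (int p - 1) * (int p - int (omega G)) - 2 * int (total_level G) + int (xi G)
    \<and> (\<exists>c. follows_recurrence G u c)
    \<and> (\<forall>c. follows_recurrence G u c \<longrightarrow> hamiltonian_coloring G c \<and> hc_coloring G c = hc G)"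
proof -
  interpret complete_blocks G using assms(1) by (rule block_graph_complete_blocks)
  let ?value = "(int p - 1) * (int p - int (omega G)) - 2 * int (total_level G) + int (xi G)"
  have bij: "bij_betw u {..<card (verts G)} (verts G)" using assms(2,3) by simp
  have omega: "omega G = 1 \<or> omega G \<ge> 2" using omega_pos by linarith
  have uV: "u i \<in> verts G" if "i < p" for i using that bij_betwE[OF assms(3)] by simp
  \<comment> \<open>Both boundary conditions take the one form in which \<open>sum_gaps\<close> uses
    them: \<open>0 + xi G\<close> for one central vertex, and \<open>0 + 0\<close> with
    \<open>xi G = 0\<close> for more.\<close>
  have ends: "level G (u 0) + level G (u (p - 1)) = xi G"
    using omega assms(4,5) by (auto simp: xi_def)
  have dist: "int (detour_dist G (u i) (u (i + 1)))
      = int (level G (u i)) + int (level G (u (i + 1))) + int (omega G) - 1" if i: "i + 1 < p" for i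
    using omega
  proof
    assume "omega G = 1"
    with assms(6)[OF _ i] i show ?thesis
      using detour_dist_different_branches[of "u i" "u (i + 1)"] uV by simp
  next
    assume "omega G \<ge> 2"
    with assms(7)[OF _ i] i show ?thesis
      using detour_dist_opposite_branches[of "u i" "u (i + 1)"] uV by (simp add: of_nat_diff)
  qed
  have half: "2 * detour_dist G (u i) (u (i + 1)) \<le> p" if "i + 1 < p" for i
    using assms(8)[OF that] by linarith
  \<comment> \<open>Nonnegative increments: the left side is the detour distance plus
    \<open>1\<close>, and a path has at most \<open>p - 1\<close> arcs.\<close>
  have "int (level G (u i)) + int (level G (u (i + 1))) + int (omega G) \<le> int p" if "i + 1 < p" for i
    using dist[OF that] detour_dist_less_card[OF uV uV, of i "i + 1"] that assms(2) by simp
  then have ex: "\<exists>c. follows_recurrence G u c"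
    using bij_betw_imp_inj_on[OF bij] assms(2) verts_nonempty
    by (intro follows_recurrence_exists) (auto simp: card_gt_0_iff)
  have good: "hamiltonian_coloring G c \<and> int (hc_coloring G c) = ?value" if "follows_recurrence G u c" for c
    using recurrence_properties[OF bij _ _ that] dist half assms(2) sum_gaps[OF bij] ends by simp
  \<comment> \<open>With one vertex the indices \<open>0\<close> and \<open>p - 1\<close> coincide,
    so for a unique center the same level equals both \<open>0\<close> and
    \<open>xi G\<close>.\<close>
  have small: "int (xi G) \<le> 0" if "card (verts G) = 1"
    using that ends assms(2,4,5) omega by auto
  have lower: "?value \<le> int (hc_coloring G c)" if "hamiltonian_coloring G c" for c
    using hc_coloring_lower_bound[OF that small] assms(2) by simp
  obtain c where c: "follows_recurrence G u c" using ex ..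
  have "hc G = hc_coloring G c"
    unfolding hc_def
  proof (rule cInf_eq_minimum)
    show "hc_coloring G c \<in> {hc_coloring G c |c. hamiltonian_coloring G c}"
      using good[OF c] by auto
    fix n assume "n \<in> {hc_coloring G c |c. hamiltonian_coloring G c}"
    with lower good[OF c] show "hc_coloring G c \<le> n" by fastforce
  qed
  then have hc: "int (hc G) = ?value" using good[OF c] by simp
  moreover have "hamiltonian_coloring G c \<and> hc_coloring G c = hc G" if "follows_recurrence G u c" for c
  proof -
    have "int (hc_coloring G c) = int (hc G)" using good[OF that] hc by simp
    with good[OF that] show ?thesis by simp
  qed
  ultimately show ?thesis using ex by blast
qed

end
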